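(* Let $d\ge 1$ and let $\mu(\mathfrak r_1),\ldots,\mu(\mathfrak r_d)$ be laws belonging to one and the same Meixner class $\mathcal M(\mathfrak u)$; write $\mathfrak r=(\mathfrak r_1,\ldots,\mathfrak r_d)$ and $\mu_\otimes(\mathfrak r)=\mu(\mathfrak r_1)\otimes\cdots\otimes\mu(\mathfrak r_d)$. Let $Y=(Y_1,\ldots,Y_d)$ be a random vector whose law is $H\,d\mu_\otimes(\mathfrak r)$, where $H\ge 0$ is a probability density with respect to $\mu_\otimes(\mathfrak r)$ with $\int H^2\,d\mu_\otimes(\mathfrak r)<\infty$ and mean square expansion $$H(x)=\sum_{n_1,\ldots,n_d\ge 0}H_{n_1,\ldots,n_d}\prod_{i=1}^dP_{n_i}(x_i;\mathfrak r_i).$$ Then: (1) $Y_1,\ldots,Y_d$ have laws $\mu(\mathfrak r_1),\ldots,\mu(\mathfrak r_d)$ respectively if and only if for every $i=1,\ldots,d$ and every $m\ge 1$, $H_{n(i,m)}=0$, where $n(i,m)=(0,\ldots,0,m,0,\ldots,0)$ with $m$ in position $i$. (2) $Y_1+\cdots+Y_d$ has law $\mu(\mathfrak r_1)*\cdots*\mu(\mathfrak r_d)$ if and only if for every $m\ge 1$, $$\sum_{n_1+\cdots+n_d=m}H_{n_1,\ldots,n_d}\,\frac{1}{\prod_{i=1}^dn_i!}\prod_{i=1}^d\mathfrak h_{n_i}(\mathfrak r_i)=0.$$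
   Context: Meixner classes. Let $\mathfrak u$ be a real function with a power series expansion near $0$, $\mathfrak u(0)=0$, $\mathfrak u'(0)=1$. The Meixner class $\mathcal M(\mathfrak u)$ is the set of probability laws $\mu$ on $\mathbb R$ with positive variance, whose moment generating function $M(t)=\int e^{tx}\mu(dx)$ is finite in an open interval containing $0$, and such that the polynomials $P_n$ (monic of degree $n$) defined by $\frac{e^{x\mathfrak u(z)}}{M(\mathfrak u(z))}=\sum_{n\ge0}P_n(x)\frac{z^n}{n!}$ for $z$ near $0$ are orthogonal: $\int P_mP_n\,d\mu=0$ for $m\ne n$. With $\mathfrak v$ the inverse of $\mathfrak u$ near $0$, one has $M'(t)/M(t)=\mathfrak s^2\mathfrak v(t)+\mathfrak m$, where $\mathfrak m,\mathfrak s^2$ are the mean and variance of $\mu$; hence a law in $\mathcal M(\mathfrak u)$ is determined by $\mathfrak r=(\mathfrak m,\mathfrak s^2)$ and is denoted $\mu(\mathfrak r)$; its polynomials are $P_n(\cdot;\mathfrak r)$ and $\mathfrak h_n(\mathfrak r)=\int P_n(x;\mathfrak r)^2\mu(\mathfrak r)(dx)$. It is known that $(P_n(\cdot;\mathfrak r))_n$ is a complete orthogonal system in $L^2(\mu(\mathfrak r))$, and that if $\mu(\mathfrak r_1),\mu(\mathfrak r_2)\in\mathcal M(\mathfrak u)$ then $\mu(\mathfrak r_1)*\mu(\mathfrak r_2)=\mu(\mathfrak r_1+\mathfrak r_2)\in\mathcal M(\mathfrak u)$. Coefficients. If $X$ has law $\mu_\otimes(\mathfrak r)$, the coefficients are $H_{n_1,\ldots,n_d}=\mathbb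 E[H(X)\prod_iP_{n_i}(X_i;\mathfrak r_i)]/\prod_i\mathfrak h_{n_i}(\mathfrak r_i)$; when some $\mathfrak h_{n_i}(\mathfrak r_i)=0$ (only possible for laws with finite support), $H_{n_1,\ldots,n_d}:=0$. In particular $H_{0,\ldots,0}=1$. *)

theory Defs
  imports "HOL-Probability.Probability" "HOL-Computational_Algebra.Computational_Algebra"
begin

definition meixner_generator :: "(real \<Rightarrow> real) \<Rightarrow> bool" where
  "meixner_generator u \<longleftrightarrow>
     (\<exists>F. u has_fps_expansion F) \<and> u 0 = 0 \<and> (u has_real_derivative 1) (at 0)"

definition mgf :: "real measure \<Rightarrow> real \<Rightarrow> real" where
  "mgf \<mu> t = (LINT x|\<mu>. exp (t * x))"

definition finite_mgf_near_0 :: "real measure \<Rightarrow> bool" where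
  "finite_mgf_near_0 \<mu> \<longleftrightarrow>
     (\<exists>\<epsilon>>0. \<forall>t\<in>{-\<epsilon><..<\<epsilon>}. integrable \<mu> (\<lambda>x. exp (t * x)))"

definition meixner_system :: "(real \<Rightarrow> real) \<Rightarrow> real measure \<Rightarrow> (nat \<Rightarrow> real poly) \<Rightarrow> bool" where
  "meixner_system u \<mu> P \<longleftrightarrow>
     (\<forall>n. degree (P n) = n \<and> lead_coeff (P n) = 1) \<and>
     (\<forall>x. (\<lambda>z. exp (x * u z) / mgf \<mu> (u z)) has_fps_expansion
             Abs_fps (\<lambda>n. poly (P n) x / fact n))"

definition meixner_class :: "(real \<Rightarrow> real) \<Rightarrow> real measure set" where
  "meixner_class u = {\<mu>.
     prob_space \<mu> \<and> sets \<mu> = sets borel \<and>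
     0 < prob_space.variance \<mu> (\<lambda>x. x) \<and>
     finite_mgf_near_0 \<mu> \<and>
     (\<exists>P. meixner_system u \<mu> P \<and>
          (\<forall>m n. m \<noteq> n \<longrightarrow> (LINT x|\<mu>. poly (P m) x * poly (P n) x) = 0))}"

(* A law of the class is determined by its mean and variance, so polynomials and norms
   are indexed below by the law itself instead of by the pair (mean, variance). *)
definition meixner_poly :: "(real \<Rightarrow> real) \<Rightarrow> real measure \<Rightarrow> nat \<Rightarrow> real poly" where
  "meixner_poly u \<mu> = (THE P. meixner_system u \<mu> P)"

lemma real_has_fps_expansion_unique:
  fixes f :: "real \<Rightarrow> real"
  assumes F: "f has_fps_expansion F" and G: "f has_fps_expansion G"
  shows "F = G"
proof -
  have "eventually (\<lambda>z. eval_fps F z = eval_fps G z) (nhds 0)"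
    using F G unfolding has_fps_expansion_def by (auto elim: eventually_elim2)
  then obtain e where e: "e > 0" "\<And>z. \<bar>z\<bar> < e \<Longrightarrow> eval_fps F z = eval_fps G z"
    by (auto simp: eventually_nhds_metric dist_real_def)
  have "0 < min (ereal e) (min (fps_conv_radius F) (fps_conv_radius G))"
    using F G e(1) by (auto simp: has_fps_expansion_def)
  then obtain s where s: "0 < ereal s"
      "ereal s < min (ereal e) (min (fps_conv_radius F) (fps_conv_radius G))"
    using ereal_dense2 by blast
  define c where "c = (\<lambda>n. fps_nth F n - fps_nth G n)"
  have c: "(\<lambda>n. c n * z ^ n) sums 0" if "\<bar>z\<bar> < s" for z
  proof -
    have lt: "ereal \<bar>z\<bar> < ereal s" using that by simp
    have "ereal (norm z) < fps_conv_radius F" "ereal (norm z) < fps_conv_radius G"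
      using less_trans[OF lt s(2)] by auto
    from sums_diff[OF sums_eval_fps[OF this(1)] sums_eval_fps[OF this(2)]]
    show ?thesis using e(2)[of z] that s(2) by (simp add: c_def left_diff_distrib)
  qed
  have "c n = 0" for n
  proof (induction n rule: less_induct)
    case (less n)
    have "((\<lambda>_. 0) \<longlongrightarrow> c (0 + n)) (at (0::real))"
    proof (rule powser_limit_0_strong[of s])
      fix z :: real assume z: "z \<noteq> 0" "norm z < s"
      have "(\<Sum>k<n. c k * z ^ k) = 0" using less by simp
      then have "(\<lambda>k. c (k + n) * z ^ (k + n)) sums 0"
        using c[of z] z(2) by (subst sums_iff_shift) simp
      then have "(\<lambda>k. c (k + n) * z ^ (k + n) / z ^ n) sums (0 / z ^ n)"
        by (rule sums_divide)
      then show "(\<lambda>k. c (k + n) * z ^ k) sums 0" using z(1) by (simp add: power_add)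
    qed (use s(1) in simp)
    then show ?case by (simp add: tendsto_const_iff)
  qed
  then show ?thesis by (intro fps_ext) (simp add: c_def)
qed

lemma meixner_poly_eq:
  assumes "meixner_system u \<mu> P"
  shows "meixner_poly u \<mu> = P"
proof -
  have "Q = P" if Q: "meixner_system u \<mu> Q" for Q
  proof -
    have "poly (Q n) x = poly (P n) x" for n x
    proof -
      have "Abs_fps (\<lambda>n. poly (Q n) x / fact n) = Abs_fps (\<lambda>n. poly (P n) x / fact n)"
        using assms Q unfolding meixner_system_def
        by (blast intro: real_has_fps_expansion_unique)
      from arg_cong[OF this, of "\<lambda>F. fps_nth F n"] show ?thesis by simp
    qed
    then show "Q = P" by (intro ext) (simp add: poly_eq_poly_eq_iff[symmetric] fun_eq_iff)
  qed
  then show ?thesis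
    unfolding meixner_poly_def using assms by blast
qed

definition meixner_sqnorm :: "(real \<Rightarrow> real) \<Rightarrow> real measure \<Rightarrow> nat \<Rightarrow> real" where
  "meixner_sqnorm u \<mu> n = (LINT x|\<mu>. (poly (meixner_poly u \<mu> n) x)\<^sup>2)"

(* Coefficient of the mean square expansion of H. By completeness of the polynomials the
   expansion with these coefficients holds for every square integrable H. Only the values
   n i with i < d matter. *)
definition meixner_coeff ::
  "(real \<Rightarrow> real) \<Rightarrow> nat \<Rightarrow> (nat \<Rightarrow> real measure) \<Rightarrow> ((nat \<Rightarrow> real) \<Rightarrow> real) \<Rightarrow> (nat \<Rightarrow> nat) \<Rightarrow> real" where
  "meixner_coeff u d \<mu> H n =
     (if \<exists>i<d. meixner_sqnorm u (\<mu> i) (n i) = 0 then 0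
      else (LINT x|PiM {..<d} \<mu>. H x * (\<Prod>i<d. poly (meixner_poly u (\<mu> i) (n i)) (x i)))
             / (\<Prod>i<d. meixner_sqnorm u (\<mu> i) (n i)))"

primrec iterated_convolution :: "(nat \<Rightarrow> real measure) \<Rightarrow> nat \<Rightarrow> real measure" where
  "iterated_convolution \<mu> 0 = return borel 0"
| "iterated_convolution \<mu> (Suc d) = (iterated_convolution \<mu> d \<star> \<mu> d)"

end

(* The exponential moments of the laws survive multiplication by a square integrable density
   (Cauchy-Schwarz), so every law in sight is determined by its integrals against a sequence of
   polynomials R_m of degree m.  For the i-th marginal take R_m = P_m(.; r_i).  For the sum take
   the coefficients Q_m of the product of the d generating functions: that product depends on x
   only through x_1 + ... + x_d, so
   Q_m(x_1 + ... + x_d) = sum over n_1 + ... + n_d = m of prod_i P_{n_i}(x_i) / n_i!.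
   These polynomials are centred under the product law for m >= 1, so equality of laws amounts
   to E[H R_m] = 0 for all m >= 1, which is the stated condition on the coefficients. *)
theory Submission
  imports Defs
begin

section \<open>Laws with exponential moments and the polynomials that determine them\<close>

text \<open>The gap between s and c absorbs the power: a single term of the exponential series of
  \<open>(c - s) * |x|\<close> is at most the whole series, so \<open>|x| ^ n\<close> is at most a
  constant times \<open>exp ((c - s) * |x|)\<close>.\<close>

lemma integrable_power_exp_abs:
  fixes N :: "real measure"
  assumes [measurable_cong]: "sets N = sets borel"
    and int: "integrable N (\<lambda>x. exp (c * \<bar>x\<bar>))" and s: "s < c"
  shows "integrable N (\<lambda>x. \<bar>x\<bar> ^ n * exp (s * \<bar>x\<bar>))"
proof (rule Bochner_Integration.integrable_bound)
  show "integrable N (\<lambda>x. fact n / (c - s) ^ n * exp (c * \<bar>x\<bar>))"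
    using int by simp
  have "\<bar>x\<bar> ^ n * exp (s * \<bar>x\<bar>) \<le> fact n / (c - s) ^ n * exp (c * \<bar>x\<bar>)" for x :: real
  proof -
    define a where "a = (c - s) * \<bar>x\<bar>"
    have a: "a \<ge> 0" using s by (simp add: a_def)
    have "a ^ n / fact n \<le> exp a"
      using sums_le[OF _ sums_single[of n "\<lambda>n. a ^ n / fact n"] exp_converges[of a]] a
      by (simp add: divide_inverse mult.commute)
    then have "\<bar>x\<bar> ^ n \<le> fact n / (c - s) ^ n * exp a"
      using s unfolding a_def power_mult_distrib
      by (simp add: pos_divide_le_eq pos_le_divide_eq mult.commute)
    then have "\<bar>x\<bar> ^ n * exp (s * \<bar>x\<bar>) \<le> fact n / (c - s) ^ n * exp a * exp (s * \<bar>x\<bar>)"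
      by (intro mult_right_mono) auto
    also have "\<dots> = fact n / (c - s) ^ n * exp (c * \<bar>x\<bar>)"
      by (simp add: a_def exp_add[symmetric] algebra_simps)
    finally show ?thesis .
  qed
  then show "AE x in N. norm (\<bar>x\<bar> ^ n * exp (s * \<bar>x\<bar>)) \<le> norm (fact n / (c - s) ^ n * exp (c * \<bar>x\<bar>))"
    using s by (intro AE_I2) (simp add: abs_mult)
qed measurable

lemma integrable_poly_exp_abs:
  fixes N :: "real measure"
  assumes [measurable_cong]: "sets N = sets borel"
    and int: "integrable N (\<lambda>x. exp (c * \<bar>x\<bar>))" and c: "0 < c"
  shows "integrable N (poly p)"
proof -
  have "integrable N (\<lambda>x. x ^ n)" for n
    \<comment> \<open>The preceding bound is used with exponent s = 0, which is admissible because c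
      is positive.\<close>
    by (rule Bochner_Integration.integrable_bound[OF integrable_power_exp_abs[OF assms, of n]])
       (auto simp: power_abs)
  then show ?thesis
    unfolding poly_altdef by (intro Bochner_Integration.integrable_sum integrable_mult_right)
qed

text \<open>Up to the factor \<open>\<i> ^ n\<close>, the integral is the n-th derivative of the
  characteristic function at t, and the series is its Taylor expansion there. Expanding
  \<open>iexp (s * x)\<close> and integrating termwise is legitimate because the norms of the terms
  add up to \<open>|x| ^ n * exp (|s| * |x|)\<close>, which is integrable for
  \<open>|s| < c\<close>.\<close>

lemma char_moment_taylor:
  fixes N :: "real measure"
  assumes N[measurable_cong]: "sets N = sets borel"
    and int: "integrable N (\<lambda>x. exp (c * \<bar>x\<bar>))" and s: "\<bar>s\<bar> < c"
  shows "(\<lambda>k. (\<i> * of_real s) ^ k / fact k * (CLINT x|N. of_real x ^ (n + k) * iexp (t * x)))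
           sums (CLINT x|N. of_real x ^ n * iexp ((t + s) * x))"
proof -
  define f where "f = (\<lambda>k x. (\<i> * of_real s) ^ k / fact k * (of_real x ^ (n + k) * iexp (t * x)))"
  have norm_f: "norm (f k x) = \<bar>x\<bar> ^ n * ((\<bar>s\<bar> * \<bar>x\<bar>) ^ k / fact k)" for k x
    by (simp add: f_def norm_mult norm_divide norm_power power_add power_mult_distrib)
  have f_sums: "(\<lambda>k. f k x) sums (of_real x ^ n * iexp ((t + s) * x))" for x
  proof -
    have "(\<lambda>k. of_real x ^ n * iexp (t * x) * ((\<i> * of_real (s * x)) ^ k /\<^sub>R fact k))
            sums (of_real x ^ n * iexp (t * x) * iexp (s * x))"
      by (intro sums_mult exp_converges)
    moreover have "of_real x ^ n * iexp (t * x) * ((\<i> * of_real (s * x)) ^ k /\<^sub>R fact k) = f k x" for k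
      by (simp add: f_def scaleR_conv_of_real power_mult_distrib power_add field_simps)
    moreover have "of_real x ^ n * iexp (t * x) * iexp (s * x) = of_real x ^ n * iexp ((t + s) * x)"
      by (simp add: exp_add[symmetric] algebra_simps)
    ultimately show ?thesis by (simp only:)
  qed
  have norm_sums: "(\<lambda>k. norm (f k x)) sums (\<bar>x\<bar> ^ n * exp (\<bar>s\<bar> * \<bar>x\<bar>))" for x
    unfolding norm_f using exp_converges[of "\<bar>s\<bar> * \<bar>x\<bar>"]
    by (intro sums_mult) (simp add: divide_inverse mult.commute)
  have int_bd: "integrable N (\<lambda>x. \<bar>x\<bar> ^ n * exp (\<bar>s\<bar> * \<bar>x\<bar>))"
    by (rule integrable_power_exp_abs[OF N int s])
  have part: "(\<Sum>k\<in>K. norm (f k x)) \<le> \<bar>x\<bar> ^ n * exp (\<bar>s\<bar> * \<bar>x\<bar>)" if "finite K" for K x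
    using norm_sums[of x] that by (metis norm_ge_zero sum_le_suminf sums_iff)
  have [measurable]: "f k \<in> borel_measurable N" for k
    unfolding f_def by measurable
  have int_f: "integrable N (f k)" for k
    using part[of "{k}"] by (intro Bochner_Integration.integrable_bound[OF int_bd]) auto
  have "(\<lambda>k. integral\<^sup>L N (f k)) sums (CLINT x|N. \<Sum>k. f k x)"
  proof (rule sums_integral[OF int_f])
    show "AE x in N. summable (\<lambda>k. norm (f k x))"
      using norm_sums by (auto simp: sums_iff)
    show "summable (\<lambda>k. LINT x|N. norm (f k x))"
    proof (rule summableI_nonneg_bounded)
      fix K
      have "(\<Sum>k<K. (LINT x|N. norm (f k x))) = (LINT x|N. (\<Sum>k<K. norm (f k x)))"
        using int_f by (intro Bochner_Integration.integral_sum[symmetric]) auto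
      also have "\<dots> \<le> (LINT x|N. \<bar>x\<bar> ^ n * exp (\<bar>s\<bar> * \<bar>x\<bar>))"
        using int_f part by (intro integral_mono[OF _ int_bd]) auto
      finally show "(\<Sum>k<K. (LINT x|N. norm (f k x))) \<le> (LINT x|N. \<bar>x\<bar> ^ n * exp (\<bar>s\<bar> * \<bar>x\<bar>))" .
    qed auto
  qed
  moreover have "(\<Sum>k. f k x) = of_real x ^ n * iexp ((t + s) * x)" for x
    using f_sums[of x] by (simp add: sums_iff)
  moreover have "integral\<^sup>L N (f k)
      = (\<i> * of_real s) ^ k / fact k * (CLINT x|N. of_real x ^ (n + k) * iexp (t * x))" for k
    unfolding f_def by simp
  ultimately show ?thesis by simp
qed

text \<open>The Taylor series of the characteristic function and its derivatives has radius of convergence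
  at least \<open>c\<close> around every point, so equality propagates from \<open>0\<close> to the line in steps of \<open>c / 2\<close>.\<close>
lemma real_distribution_eq_if_moments_eq:
  assumes N1: "real_distribution N1" and N2: "real_distribution N2"
    and int1: "integrable N1 (\<lambda>x. exp (c * \<bar>x\<bar>))" and int2: "integrable N2 (\<lambda>x. exp (c * \<bar>x\<bar>))"
    and c: "0 < c" and moments: "\<And>n. (LINT x|N1. x ^ n) = (LINT x|N2. x ^ n)"
  shows "N1 = N2"
proof -
  interpret N1: real_distribution N1 by fact
  interpret N2: real_distribution N2 by fact
  \<comment> \<open>All powers n are carried through the induction together: the Taylor coefficients
    around one centre are integrals of the same kind with higher powers.\<close>
  have step: "(CLINT x|N1. of_real x ^ n * iexp (t * x)) = (CLINT x|N2. of_real x ^ n * iexp (t * x))"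
    if "\<bar>t\<bar> \<le> real k * (c / 2)" for k n t
    using that
  proof (induction k arbitrary: n t)
    case 0
    then show ?case
      using moments[of n] by (simp flip: of_real_power)
  next
    case (Suc k)
    \<comment> \<open>The centre r lies on the segment from 0 to t at the fraction k / (k + 1). This
      puts it in the range of the induction hypothesis and leaves an increment s of size at most c /
      2, strictly inside the disc of convergence.\<close>
    define r where "r = t * (real k / real (Suc k))"
    define s where "s = t / real (Suc k)"
    have t: "t = r + s"
      by (simp add: r_def s_def divide_simps) (simp add: algebra_simps)
    have "\<bar>r\<bar> = \<bar>t\<bar> / real (Suc k) * real k"
      by (simp add: r_def abs_mult)
    also have "\<dots> \<le> (c / 2) * real k"
      using Suc.prems by (intro mult_right_mono) (auto simp: field_simps)
    finally have r: "\<bar>r\<bar> \<le> real k * (c / 2)" by (simp add: mult.commute)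
    have "\<bar>s\<bar> = \<bar>t\<bar> / real (Suc k)"
      by (simp add: s_def)
    also have "\<dots> \<le> c / 2"
      using Suc.prems by (auto simp: field_simps)
    finally have s: "\<bar>s\<bar> < c" using c by simp
    show ?case
      \<comment> \<open>By the induction hypothesis at r both Taylor series have the same terms,
        hence the same sum.\<close>
      using char_moment_taylor[OF N1.events_eq_borel int1 s, of n r]
            char_moment_taylor[OF N2.events_eq_borel int2 s, of n r]
      unfolding t Suc.IH[OF r] by (rule sums_unique2)
  qed
  have "char N1 t = char N2 t" for t
  proof -
    obtain k :: nat where "\<bar>t\<bar> / (c / 2) \<le> real k"
      using real_arch_simple by blast
    then have "\<bar>t\<bar> \<le> real k * (c / 2)"
      using c by (simp add: field_simps)
    from step[OF this, of 0] show ?thesis by (simp add: char_def)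
  qed
  then show ?thesis
    by (intro Levy_uniqueness N1 N2 ext)
qed

text \<open>Subtracting a multiple of \<open>R m\<close> removes the leading term of a polynomial of
  degree m, so induction on the degree reaches every polynomial, in particular every monomial.
  Constants are settled by the total mass 1, which is why only m >= 1 is demanded.\<close>

lemma real_distribution_eq_if_poly_basis_eq:
  fixes R :: "nat \<Rightarrow> real poly"
  assumes N1: "real_distribution N1" and N2: "real_distribution N2"
    and int1: "integrable N1 (\<lambda>x. exp (c * \<bar>x\<bar>))" and int2: "integrable N2 (\<lambda>x. exp (c * \<bar>x\<bar>))"
    and c: "0 < c"
    and deg: "\<And>m. degree (R m) = m"
    and R: "\<And>m. m \<ge> 1 \<Longrightarrow> (LINT x|N1. poly (R m) x) = (LINT x|N2. poly (R m) x)"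
  shows "N1 = N2"
proof -
  interpret N1: real_distribution N1 by fact
  interpret N2: real_distribution N2 by fact
  note int = integrable_poly_exp_abs[OF N1.events_eq_borel int1 c]
             integrable_poly_exp_abs[OF N2.events_eq_borel int2 c]
  have "(LINT x|N1. poly p x) = (LINT x|N2. poly p x)" for p
  proof (induction "degree p" arbitrary: p rule: less_induct)
    case less
    show ?case
    proof (cases "degree p = 0")
      case True
      then obtain a where "p = [:a:]" by (metis degree_eq_zeroE)
      then have "poly p = (\<lambda>_. a)" by (simp add: fun_eq_iff)
      then show ?thesis using N1.prob_space N2.prob_space by simp
    next
      case False
      define m where "m = degree p"
      define a where "a = lead_coeff p / lead_coeff (R m)"
      define q where "q = p - smult a (R m)"
      have "R m \<noteq> 0" using deg[of m] False by (auto simp: m_def)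
      then have "coeff (R m) m \<noteq> 0" by (metis deg leading_coeff_0_iff)
      then have "coeff q m = 0"
        using deg[of m] by (simp add: q_def a_def m_def)
      moreover have "degree q \<le> m"
        unfolding q_def by (rule degree_diff_le) (auto simp: deg m_def)
      \<comment> \<open>If q has degree m, its vanishing m-th coefficient forces q = 0 and hence m =
        0, which is excluded here.\<close>
      ultimately have "degree q < m"
        using False by (metis degree_0 le_neq_implies_less leading_coeff_0_iff m_def not_gr_zero)
      then have q: "(LINT x|N1. poly q x) = (LINT x|N2. poly q x)"
        using less by (simp add: m_def)
      have p: "poly p = (\<lambda>x. poly q x + a * poly (R m) x)"
        by (simp add: q_def fun_eq_iff)
      have "m \<ge> 1" using False by (simp add: m_def)
      from q R[OF this] show ?thesis
        unfolding p using int by simp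
    qed
  qed
  from this[of "monom 1 n" for n] show ?thesis
    by (intro real_distribution_eq_if_moments_eq[OF N1 N2 int1 int2 c]) (simp add: poly_monom)
qed

section \<open>Change of law by a square integrable density\<close>

lemma integrable_mult_of_squares:
  fixes f g :: "'a \<Rightarrow> real"
  assumes [measurable]: "f \<in> borel_measurable M" "g \<in> borel_measurable M"
    and "integrable M (\<lambda>x. (f x)\<^sup>2)" "integrable M (\<lambda>x. (g x)\<^sup>2)"
  shows "integrable M (\<lambda>x. f x * g x)"
proof (rule Bochner_Integration.integrable_bound)
  show "integrable M (\<lambda>x. (f x)\<^sup>2 + (g x)\<^sup>2)"
    using assms by simp
  have "\<bar>f x * g x\<bar> \<le> (f x)\<^sup>2 + (g x)\<^sup>2" for x
  proof -
    have "2 * (\<bar>f x\<bar> * \<bar>g x\<bar>) \<le> (f x)\<^sup>2 + (g x)\<^sup>2"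
      using sum_squares_bound[of "\<bar>f x\<bar>" "\<bar>g x\<bar>"] by (simp add: mult.assoc)
    moreover have "0 \<le> \<bar>f x\<bar> * \<bar>g x\<bar>" by simp
    ultimately show ?thesis unfolding abs_mult by linarith
  qed
  then show "AE x in M. norm (f x * g x) \<le> norm ((f x)\<^sup>2 + (g x)\<^sup>2)"
    by (intro AE_I2) simp
qed measurable

text \<open>The common core of both equivalences, with T a coordinate or the sum of the coordinates.
  The centring assumption makes the integrals under the unweighted law vanish, so comparing the two
  laws on the basis R leaves exactly the weighted integrals.\<close>

lemma distr_density_eq_iff_poly_basis:
  fixes R :: "nat \<Rightarrow> real poly"
  assumes K: "prob_space K"
    and H[measurable]: "H \<in> borel_measurable K" and H0: "AE x in K. 0 \<le> H x"
    and H1: "(\<integral>\<^sup>+ x. ennreal (H x) \<partial>K) = 1" and H2: "integrable K (\<lambda>x. (H x)\<^sup>2)"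
    and T[measurable]: "T \<in> borel_measurable K"
    and c: "0 < c" and exp: "integrable K (\<lambda>x. exp (c * \<bar>T x\<bar>))"
    and deg: "\<And>m. degree (R m) = m"
    and R: "\<And>m. m \<ge> 1 \<Longrightarrow> (LINT x|K. poly (R m) (T x)) = 0"
  shows "distr (density K H) borel T = distr K borel T
           \<longleftrightarrow> (\<forall>m\<ge>1. (LINT x|K. H x * poly (R m) (T x)) = 0)"
proof -
  define N1 where "N1 = distr (density K H) borel T"
  define N2 where "N2 = distr K borel T"
  have [measurable]: "poly p \<in> borel_measurable borel" for p :: "real poly"
    by (intro borel_measurable_continuous_onI continuous_intros)
  interpret K: prob_space K by fact
  interpret D: prob_space "density K H"
    by (rule prob_spaceI) (simp add: emeasure_density H1 cong: nn_integral_cong)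
  have N: "real_distribution N1" "real_distribution N2"
    unfolding N1_def N2_def real_distribution_def real_distribution_axioms_def
    by (auto intro: D.prob_space_distr K.prob_space_distr)
  have L1: "(LINT x|N1. poly p x) = (LINT x|K. H x * poly p (T x))" for p
    unfolding N1_def using H0 by (subst integral_distr) (auto simp: integral_density)
  have L2: "(LINT x|N2. poly p x) = (LINT x|K. poly p (T x))" for p
    unfolding N2_def by (subst integral_distr) auto
  have "integrable K (\<lambda>x. exp (c / 2 * \<bar>T x\<bar>))"
  proof (rule Bochner_Integration.integrable_bound[OF exp])
    show "AE x in K. norm (exp (c / 2 * \<bar>T x\<bar>)) \<le> norm (exp (c * \<bar>T x\<bar>))"
      using c by (intro AE_I2) (simp add: mult_right_mono)
  qed measurable
  then have int2: "integrable N2 (\<lambda>x. exp (c / 2 * \<bar>x\<bar>))"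
    unfolding N2_def by (subst integrable_distr_eq) auto
  \<comment> \<open>Halving the exponent pays for the product with H: the square of
    \<open>exp (c / 2 * |T x|)\<close> is \<open>exp (c * |T x|)\<close>.\<close>
  have "integrable K (\<lambda>x. H x * exp (c / 2 * \<bar>T x\<bar>))"
    using H2 exp by (intro integrable_mult_of_squares) (auto simp flip: exp_double)
  then have int1: "integrable N1 (\<lambda>x. exp (c / 2 * \<bar>x\<bar>))"
    unfolding N1_def using H0 by (subst integrable_distr_eq) (auto simp: integrable_density)
  show ?thesis
  proof
    assume "distr (density K H) borel T = distr K borel T"
    then have "N1 = N2" by (simp add: N1_def N2_def)
    then show "\<forall>m\<ge>1. (LINT x|K. H x * poly (R m) (T x)) = 0"
      by (metis L1 L2 R)
  next
    assume "\<forall>m\<ge>1. (LINT x|K. H x * poly (R m) (T x)) = 0"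
    then have "N1 = N2"
      using c R by (intro real_distribution_eq_if_poly_basis_eq[OF N int1 int2 _ deg]) (auto simp: L1 L2)
    then show "distr (density K H) borel T = distr K borel T"
      by (simp add: N1_def N2_def)
  qed
qed


section \<open>Products of generating functions\<close>

text \<open>The formula \<open>fps_prod_nth'\<close> sums over multisets of size m in A. Such a
  multiset amounts to its multiplicity function on A, and extensionality outside A makes this
  correspondence bijective.\<close>

lemma fps_prod_nth_PiE:
  fixes f :: "'i \<Rightarrow> 'a::comm_semiring_1 fps"
  assumes A: "finite A"
  shows "fps_nth (\<Prod>i\<in>A. f i) m
           = (\<Sum>n | n \<in> A \<rightarrow>\<^sub>E UNIV \<and> (\<Sum>i\<in>A. n i) = m. \<Prod>i\<in>A. fps_nth (f i) (n i))"
proof -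
  have count_Abs: "count (Abs_multiset (\<lambda>i. if i \<in> A then n i else 0)) = (\<lambda>i. if i \<in> A then n i else 0)"
    for n :: "'i \<Rightarrow> nat"
    using A by (intro count_Abs_multiset) (auto intro: finite_subset[of _ A])
  have size: "size X = (\<Sum>i\<in>A. count X i)" if "set_mset X \<subseteq> A" for X :: "'i multiset"
    unfolding size_multiset_overloaded_eq using A that
    by (intro sum.mono_neutral_left) (auto simp: count_eq_zero_iff)
  show ?thesis
    unfolding fps_prod_nth'[OF A]
  proof (rule sum.reindex_bij_witness
      [where i = "\<lambda>n. Abs_multiset (\<lambda>i. if i \<in> A then n i else 0)" and j = "\<lambda>X. restrict (count X) A"])
    fix X :: "'i multiset" assume X: "X \<in> multisets_of_size A m"
    then have X': "set_mset X \<subseteq> A" "size X = m" by (auto simp: multisets_of_size_def)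
    show "Abs_multiset (\<lambda>i. if i \<in> A then restrict (count X) A i else 0) = X"
      using X'(1) by (intro multiset_eqI) (auto simp: count_Abs count_eq_zero_iff)
    show "restrict (count X) A \<in> {n \<in> A \<rightarrow>\<^sub>E UNIV. sum n A = m}"
      using X' size[OF X'(1)] by simp
    show "(\<Prod>i\<in>A. fps_nth (f i) (restrict (count X) A i)) = (\<Prod>i\<in>A. fps_nth (f i) (count X i))"
      by simp
  next
    fix n assume n: "n \<in> {n \<in> A \<rightarrow>\<^sub>E UNIV. sum n A = m}"
    let ?X = "Abs_multiset (\<lambda>i. if i \<in> A then n i else 0)"
    show "restrict (count ?X) A = n"
      using n by (auto simp: count_Abs PiE_def extensional_def restrict_def)
    have sub: "set_mset ?X \<subseteq> A"
      by (auto simp: set_mset_def count_Abs split: if_splits)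
    then show "?X \<in> multisets_of_size A m"
      using size[OF sub] n by (simp add: multisets_of_size_def count_Abs)
  qed
qed

lemma finite_PiE_sum_eq:
  assumes "finite A"
  shows "finite {n \<in> A \<rightarrow>\<^sub>E (UNIV :: nat set). (\<Sum>i\<in>A. n i) = m}"
proof (rule finite_subset)
  show "{n \<in> A \<rightarrow>\<^sub>E UNIV. (\<Sum>i\<in>A. n i) = m} \<subseteq> A \<rightarrow>\<^sub>E {..m}"
  proof
    fix n assume n: "n \<in> {n \<in> A \<rightarrow>\<^sub>E (UNIV :: nat set). (\<Sum>i\<in>A. n i) = m}"
    have "n i \<le> m" if "i \<in> A" for i
      using n member_le_sum[of i A n] that assms by simp
    then show "n \<in> A \<rightarrow>\<^sub>E {..m}"
      using n by (auto simp: PiE_def)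
  qed
qed (use assms in \<open>auto intro: finite_PiE\<close>)

text \<open>The generating function of the product system at \<open>x\<close> depends on \<open>x\<close> only through the sum
  of its components, so its coefficients can be computed at the point \<open>(\<Sum>i x\<^sub>i, 0, \<dots>, 0)\<close>.\<close>
lemma meixner_sum_poly_exists:
  fixes P :: "nat \<Rightarrow> nat \<Rightarrow> real poly"
  assumes d: "1 \<le> d" and P: "\<And>i. i < d \<Longrightarrow> meixner_system u (\<mu> i) (P i)"
  obtains Q :: "nat \<Rightarrow> real poly" where "\<And>m. degree (Q m) = m"
    "\<And>m x. poly (Q m) (\<Sum>i<d. x i)
       = (\<Sum>n | n \<in> {..<d} \<rightarrow>\<^sub>E UNIV \<and> (\<Sum>i<d. n i) = m. \<Prod>i<d. poly (P i (n i)) (x i) / fact (n i))"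
proof -
  define G where "G = (\<lambda>i (x::real). Abs_fps (\<lambda>n. poly (P i n) x / fact n))"
  define e :: "real \<Rightarrow> nat \<Rightarrow> real" where "e = (\<lambda>s i. if i = 0 then s else 0)"
  \<comment> \<open>The contribution of the remaining coordinates at 0: a series whose coefficients
    do not depend on x.\<close>
  define C where "C = (\<Prod>i\<in>{1..<d}. G i 0)"
  have G: "(\<lambda>z. exp (x * u z) / mgf (\<mu> i) (u z)) has_fps_expansion G i x" if "i < d" for i x
    using P[OF that] by (simp add: meixner_system_def G_def)
  have split: "{..<d} = insert 0 {1..<d}" using d by auto
  have sum_e: "(\<Sum>i<d. e s i) = s" for s
    by (simp add: split e_def)
  have prod_G: "(\<lambda>z. exp ((\<Sum>i<d. x i) * u z) / (\<Prod>i<d. mgf (\<mu> i) (u z))) has_fps_expansion (\<Prod>i<d. G i (x i))"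
    for x
    using has_fps_expansion_prod[of "{..<d}" "\<lambda>i z. exp (x i * u z) / mgf (\<mu> i) (u z)" "\<lambda>i. G i (x i)"] G
    by (simp add: prod_dividef exp_sum sum_distrib_right)
  have prod_G_e: "(\<Prod>i<d. G i (x i)) = G 0 (\<Sum>i<d. x i) * C" for x
  proof -
    \<comment> \<open>Both products expand the same function of z, since x and the point
      \<open>e\<close> have equal coordinate sums.\<close>
    have "(\<Prod>i<d. G i (x i)) = (\<Prod>i<d. G i (e (\<Sum>i<d. x i) i))"
      using prod_G[of x] prod_G[of "e (\<Sum>i<d. x i)"] unfolding sum_e
      by (rule real_has_fps_expansion_unique)
    then show ?thesis by (simp add: split e_def C_def)
  qed
  \<comment> \<open>This is the m-th Cauchy product coefficient of \<open>G 0 s * C\<close>, read as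
    a polynomial in s.\<close>
  define Q where "Q = (\<lambda>m. \<Sum>k\<le>m. smult (fps_nth C (m - k) / fact k) (P 0 k))"
  have P0: "degree (P i k) = k" "coeff (P i k) k = 1" if "i < d" for i k
    using P[OF that] unfolding meixner_system_def by metis+
  have P_0: "P i 0 = 1" if "i < d" for i
    using P0[OF that, of 0] by (metis degree_0_id one_pCons)
  have nth_0_prod: "fps_nth (\<Prod>i\<in>A. g i) 0 = (\<Prod>i\<in>A. fps_nth (g i) 0)" for A and g :: "nat \<Rightarrow> real fps"
    by (induction A rule: infinite_finite_induct) simp_all
  have C0: "fps_nth C 0 = 1"
    by (simp add: C_def nth_0_prod G_def P_0)
  have "degree (Q m) = m" for m
  proof (rule antisym)
    show "degree (Q m) \<le> m"
      unfolding Q_def using P0 d by (intro degree_sum_le) (auto intro: order_trans[OF degree_smult_le])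
    \<comment> \<open>Only k = m reaches degree m, and its weight is
      \<open>fps_nth C 0 / fact m\<close> with \<open>fps_nth C 0 = 1\<close>.\<close>
    have "coeff (Q m) m = (\<Sum>k\<le>m. if k = m then 1 / fact m else 0)"
      unfolding Q_def coeff_sum using P0[of 0] d C0 
      by (intro sum.cong) (auto simp: coeff_eq_0)
    then have "coeff (Q m) m \<noteq> 0" by simp
    then show "m \<le> degree (Q m)" by (rule le_degree)
  qed
  moreover have "poly (Q m) (\<Sum>i<d. x i)
       = (\<Sum>n | n \<in> {..<d} \<rightarrow>\<^sub>E UNIV \<and> (\<Sum>i<d. n i) = m. \<Prod>i<d. poly (P i (n i)) (x i) / fact (n i))"
    for m x
  proof -
    have "poly (Q m) (\<Sum>i<d. x i) = (\<Sum>k=0..m. fps_nth (G 0 (\<Sum>i<d. x i)) k * fps_nth C (m - k))"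
      by (simp add: Q_def poly_sum G_def atLeast0AtMost mult.commute)
    also have "\<dots> = fps_nth (\<Prod>i<d. G i (x i)) m"
      unfolding prod_G_e fps_mult_nth ..
    finally show ?thesis
      by (simp add: fps_prod_nth_PiE G_def)
  qed
  ultimately show thesis by (rule that)
qed

section \<open>Independence and iterated convolution\<close>

text \<open>The joint law of the coordinates is the product measure itself, and its factors are the
  marginals.\<close>

lemma indep_vars_PiM_coordinates:
  assumes M: "\<And>i. i \<in> I \<Longrightarrow> prob_space (M i)" and I: "I \<noteq> {}"
  shows "prob_space.indep_vars (PiM I M) M (\<lambda>i x. x i) I"
proof -
  interpret prob_space "PiM I M"
    by (rule prob_space_PiM) (rule M)
  have "distr (PiM I M) (PiM I M) (\<lambda>x. \<lambda>i\<in>I. x i) = distr (PiM I M) (PiM I M) (\<lambda>x. x)"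
    by (intro distr_cong) (auto simp: space_PiM)
  also have "\<dots> = PiM I (\<lambda>i. distr (PiM I M) (M i) (\<lambda>x. x i))"
    unfolding distr_id2[OF refl] by (intro PiM_cong refl) (rule distr_PiM_component[OF M, symmetric])
  finally show ?thesis
    using I by (subst indep_vars_iff_distr_eq_PiM') auto
qed

text \<open>Induction on d: the last variable is independent of the sum of the earlier ones. The
  independence fact puts the new variable first, whereas the recursion puts it last; commutativity
  of convolution reconciles them.\<close>

lemma (in prob_space) iterated_convolution_eq_distr_sum:
  assumes X: "indep_vars (\<lambda>_. borel) X {..<d}"
    and \<mu>: "\<And>i. i < d \<Longrightarrow> distr M borel (X i) = \<mu> i"
  shows "iterated_convolution \<mu> d = distr M borel (\<lambda>\<omega>. \<Sum>i<d. X i \<omega>)"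
  using assms
proof (induction d)
  case 0
  show ?case by (simp add: distr_const)
next
  case (Suc d)
  have [measurable]: "random_variable borel (X i)" if "i < Suc d" for i
    using Suc.prems(1) that by (auto simp: indep_vars_def)
  have "indep_vars (\<lambda>_. borel) X {..<d}"
    using Suc.prems(1) by (rule indep_vars_subset) auto
  then have IH: "iterated_convolution \<mu> d = distr M borel (\<lambda>\<omega>. \<Sum>i<d. X i \<omega>)"
    using Suc by simp
  have "indep_var borel (X d) borel (\<lambda>\<omega>. \<Sum>i<d. X i \<omega>)"
    using Suc.prems(1) by (intro indep_vars_sum) (auto simp: lessThan_Suc)
  then have "distr M borel (\<lambda>\<omega>. X d \<omega> + (\<Sum>i<d. X i \<omega>)) = (distr M borel (X d) \<star> distr M borel (\<lambda>\<omega>. \<Sum>i<d. X i \<omega>))"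
    by (rule sum_indep_random_variable) auto
  also have "\<dots> = (distr M borel (\<lambda>\<omega>. \<Sum>i<d. X i \<omega>) \<star> distr M borel (X d))"
    by (rule convolution_commutative) (auto intro!: prob_space.finite_measure prob_space_distr)
  finally show ?case
    using Suc.prems(2)[of d] by (simp add: IH add.commute)
qed


section \<open>Polynomials and exponential moments in a Meixner class\<close>

text \<open>The class only asserts that some orthogonal system exists; uniqueness of the system,
  \<open>meixner_poly_eq\<close>, transfers its properties to \<open>meixner_poly\<close>.\<close>

lemma meixner_classD:
  assumes "\<mu> \<in> meixner_class u"
  shows "prob_space \<mu>" "sets \<mu> = sets borel" "finite_mgf_near_0 \<mu>"
    "meixner_system u \<mu> (meixner_poly u \<mu>)"
    "m \<noteq> n \<Longrightarrow> (LINT x|\<mu>. poly (meixner_poly u \<mu> m) x * poly (meixner_poly u \<mu> n) x) = 0"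
  using assms by (auto simp: meixner_class_def meixner_poly_eq)

lemma degree_meixner_poly:
  assumes "\<mu> \<in> meixner_class u"
  shows "degree (meixner_poly u \<mu> n) = n"
  using meixner_classD(4)[OF assms] by (simp add: meixner_system_def)

lemma meixner_poly_0:
  assumes "\<mu> \<in> meixner_class u"
  shows "meixner_poly u \<mu> 0 = 1"
  using meixner_classD(4)[OF assms] unfolding meixner_system_def
  by (metis degree_0_id one_pCons)

text \<open>This is orthogonality to the constant polynomial of index 0.\<close>

lemma integral_meixner_poly:
  assumes "\<mu> \<in> meixner_class u" "n \<noteq> 0"
  shows "(LINT x|\<mu>. poly (meixner_poly u \<mu> n) x) = 0"
  using meixner_classD(5)[OF assms] meixner_poly_0[OF assms(1)] by simp

text \<open>An exponential of \<open>|x|\<close> is dominated by the sum of the exponentials of x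
  and -x. Half the radius keeps both inside the open interval, and allowing all s up to c lets
  finitely many laws share one constant.\<close>

lemma integrable_exp_abs_if_finite_mgf:
  assumes \<mu>[measurable_cong]: "sets \<mu> = sets borel" and "finite_mgf_near_0 \<mu>"
  obtains c where "0 < c" "\<And>s. s \<le> c \<Longrightarrow> integrable \<mu> (\<lambda>x. exp (s * \<bar>x\<bar>))"
proof -
  obtain e where e: "e > 0" "\<And>t. t \<in> {-e<..<e} \<Longrightarrow> integrable \<mu> (\<lambda>x. exp (t * x))"
    using assms(2) by (auto simp: finite_mgf_near_0_def)
  have "integrable \<mu> (\<lambda>x. exp (s * \<bar>x\<bar>))" if s: "s \<le> e / 2" for s
  proof (rule Bochner_Integration.integrable_bound)
    show "integrable \<mu> (\<lambda>x. exp ((e / 2) * x) + exp (- (e / 2) * x))"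
      using e(2)[of "e / 2"] e(2)[of "- (e / 2)"] e(1)
      by (intro Bochner_Integration.integrable_add) simp_all
    have "exp (s * \<bar>x\<bar>) \<le> exp ((e / 2) * x) + exp (- (e / 2) * x)" for x
    proof -
      have "exp (s * \<bar>x\<bar>) \<le> exp ((e / 2) * \<bar>x\<bar>)"
        using mult_right_mono[OF s, of "\<bar>x\<bar>"] by simp
      also have "\<dots> \<le> exp ((e / 2) * x) + exp (- (e / 2) * x)"
        by (cases "x \<ge> 0") (auto simp: add_increasing add_increasing2)
      finally show ?thesis .
    qed
    then show "AE x in \<mu>. norm (exp (s * \<bar>x\<bar>)) \<le> norm (exp ((e / 2) * x) + exp (- (e / 2) * x))"
      by (intro AE_I2) (auto intro: order_trans)
  qed measurable
  with e(1) show thesis by (intro that[of "e / 2"]) auto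
qed

theorem theorem2:
  fixes u :: "real \<Rightarrow> real" and d :: nat and \<mu> :: "nat \<Rightarrow> real measure"
    and \<Omega> :: "'w measure" and Y :: "nat \<Rightarrow> 'w \<Rightarrow> real" and H :: "(nat \<Rightarrow> real) \<Rightarrow> real"
  assumes "meixner_generator u"
    and "d \<ge> 1"
    and "\<And>i. i < d \<Longrightarrow> \<mu> i \<in> meixner_class u"
    and "prob_space \<Omega>"
    and "H \<in> borel_measurable (PiM {..<d} \<mu>)"
    and "AE x in PiM {..<d} \<mu>. 0 \<le> H x"
    and "(\<integral>\<^sup>+ x. ennreal (H x) \<partial>PiM {..<d} \<mu>) = 1"
    and "integrable (PiM {..<d} \<mu>) (\<lambda>x. (H x)\<^sup>2)"
    and "distributed \<Omega> (PiM {..<d} \<mu>) (\<lambda>\<omega>. \<lambda>i\<in>{..<d}. Y i \<omega>) (\<lambda>x. ennreal (H x))"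
  shows "((\<forall>i<d. distr \<Omega> borel (Y i) = \<mu> i) \<longleftrightarrow>
          (\<forall>i<d. \<forall>m\<ge>1. meixner_coeff u d \<mu> H (\<lambda>j. if j = i then m else 0) = 0)) \<and>
         (distr \<Omega> borel (\<lambda>\<omega>. \<Sum>i<d. Y i \<omega>) = iterated_convolution \<mu> d \<longleftrightarrow>
          (\<forall>m\<ge>1. (\<Sum>n | n \<in> {..<d} \<rightarrow>\<^sub>E UNIV \<and> (\<Sum>i<d. n i) = m.
              meixner_coeff u d \<mu> H n * (1 / (\<Prod>i<d. fact (n i))) *
              (\<Prod>i<d. meixner_sqnorm u (\<mu> i) (n i))) = 0))"
proof -

  \<comment> \<open>Coordinates under the product law\<close>
  define K where "K = PiM {..<d} \<mu>"
  define P where "P = (\<lambda>i. meixner_poly u (\<mu> i))"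
  define h where "h = (\<lambda>i. meixner_sqnorm u (\<mu> i))"
  note \<mu>_in_class = assms(3)
  note M = meixner_classD(1)[OF \<mu>_in_class]
  have sets_\<mu>: "sets (\<mu> i) = sets borel" if "i < d" for i
    using \<mu>_in_class[OF that] by (rule meixner_classD)
  note H = assms(5-8)[folded K_def]
  note [measurable] = H(1)
  interpret K: prob_space K
    unfolding K_def by (rule prob_space_PiM) (use M in auto)
  have coord[measurable]: "(\<lambda>x. x i) \<in> borel_measurable K" if "i < d" for i
    unfolding K_def measurable_cong_sets[OF refl sets_\<mu>[OF that, symmetric]]
    using that by (intro measurable_component_singleton) auto
  have [measurable]: "poly p \<in> borel_measurable borel" for p :: "real poly"
    by (intro borel_measurable_continuous_onI continuous_intros)
  have distr_coord: "distr K borel (\<lambda>x. x i) = \<mu> i" if "i < d" for i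
  proof -
    have "distr K borel (\<lambda>x. x i) = distr K (\<mu> i) (\<lambda>x. x i)"
      using sets_\<mu>[OF that] by (intro distr_cong) auto
    also have "\<dots> = \<mu> i"
      unfolding K_def using that M by (intro distr_PiM_component) auto
    finally show ?thesis .
  qed
  have integrable_coord: "integrable K (\<lambda>x. f (x i))" and integral_coord: "(LINT x|K. f (x i)) = (LINT x|\<mu> i. f x)"
    if "i < d" "integrable (\<mu> i) f" for i and f :: "real \<Rightarrow> real"
  proof -
    have [measurable]: "f \<in> borel_measurable borel"
      using borel_measurable_integrable[OF that(2)] unfolding measurable_cong_sets[OF sets_\<mu>[OF that(1)] refl] .
    show "integrable K (\<lambda>x. f (x i))"
      using that integrable_distr_eq[of "\<lambda>x. x i" K borel f] distr_coord by auto
    show "(LINT x|K. f (x i)) = (LINT x|\<mu> i. f x)"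
      using that integral_distr[of "\<lambda>x. x i" K borel f] distr_coord by auto
  qed

  have "K.indep_vars \<mu> (\<lambda>i x. x i) {..<d}"
    unfolding K_def using assms(2) M by (intro indep_vars_PiM_coordinates) (auto simp: lessThan_empty_iff)
  \<comment> \<open>Composing with \<open>id\<close> only replaces the target spaces
    \<open>\<mu> i\<close> by \<open>borel\<close>, which has the same sets.\<close>
  then have "K.indep_vars (\<lambda>_. borel) (\<lambda>i x. id (x i)) {..<d}"
    by (rule K.indep_vars_compose2) (auto simp: measurable_cong_sets[OF sets_\<mu> refl])
  then have indep: "K.indep_vars (\<lambda>_. borel) (\<lambda>i x. x i) {..<d}" by simp
  have indep_f: "K.indep_vars (\<lambda>_. borel) (\<lambda>i x. f i (x i)) {..<d}"
    if "\<And>i. i < d \<Longrightarrow> f i \<in> borel_measurable borel" for f :: "nat \<Rightarrow> real \<Rightarrow> real"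
    using indep by (rule K.indep_vars_compose2) (use that in auto)

  have "\<forall>i\<in>{..<d}. \<exists>c>0. \<forall>s\<le>c. integrable (\<mu> i) (\<lambda>x. exp (s * \<bar>x\<bar>))"
    using integrable_exp_abs_if_finite_mgf[OF sets_\<mu> meixner_classD(3)[OF \<mu>_in_class]] by (metis lessThan_iff)
  then obtain c' where c': "\<And>i. i < d \<Longrightarrow> 0 < c' i"
      "\<And>i s. i < d \<Longrightarrow> s \<le> c' i \<Longrightarrow> integrable (\<mu> i) (\<lambda>x. exp (s * \<bar>x\<bar>))"
    by (metis lessThan_iff)
  \<comment> \<open>The minimum of finitely many positive constants serves all d laws at once; it is
    positive because d >= 1.\<close>
  define c where "c = Min (c' ` {..<d})"
  have c: "0 < c"
    unfolding c_def using c'(1) assms(2) by (subst Min_gr_iff) (auto simp: lessThan_empty_iff)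
  have exp_int: "integrable (\<mu> i) (\<lambda>x. exp (c * \<bar>x\<bar>))" if "i < d" for i
    using that by (intro c') (auto simp: c_def)
  have poly_int: "integrable (\<mu> i) (poly p)" if "i < d" for i p
    by (rule integrable_poly_exp_abs[OF sets_\<mu>[OF that] exp_int[OF that] c])

  have prod_int: "integrable K (\<lambda>x. \<Prod>i<d. poly (p i) (x i))"
    and prod_integral: "(LINT x|K. (\<Prod>i<d. poly (p i) (x i))) = (\<Prod>i<d. LINT x|\<mu> i. poly (p i) x)"
    for p :: "nat \<Rightarrow> real poly"
  proof -
    have int: "integrable K (\<lambda>x. poly (p i) (x i))" if "i \<in> {..<d}" for i
      using that integrable_coord[OF _ poly_int] by simp
    have ind: "K.indep_vars (\<lambda>_. borel) (\<lambda>i x. poly (p i) (x i)) {..<d}"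
      by (rule indep_f) simp
    show "integrable K (\<lambda>x. \<Prod>i<d. poly (p i) (x i))"
      using K.indep_vars_integrable[OF _ ind int] by simp
    have "(LINT x|K. (\<Prod>i<d. poly (p i) (x i))) = (\<Prod>i<d. LINT x|K. poly (p i) (x i))"
      using K.indep_vars_lebesgue_integral[OF _ ind int] by simp
    also have "\<dots> = (\<Prod>i<d. LINT x|\<mu> i. poly (p i) x)"
      by (intro prod.cong refl integral_coord poly_int) auto
    finally show "(LINT x|K. (\<Prod>i<d. poly (p i) (x i))) = (\<Prod>i<d. LINT x|\<mu> i. poly (p i) x)" .
  qed
  have H_prod_int: "integrable K (\<lambda>x. H x * (\<Prod>i<d. poly (p i) (x i)))" for p :: "nat \<Rightarrow> real poly"
  proof (rule integrable_mult_of_squares)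
    \<comment> \<open>The square of a product of polynomials is again such a product, so
      \<open>prod_int\<close> applies to it.\<close>
    show "integrable K (\<lambda>x. (\<Prod>i<d. poly (p i) (x i))\<^sup>2)"
      using prod_int[of "\<lambda>i. (p i)\<^sup>2"] by (simp add: prod_power_distrib)
    show "(\<lambda>x. \<Prod>i<d. poly (p i) (x i)) \<in> borel_measurable K"
      using borel_measurable_integrable[OF prod_int] .
  qed (use H in auto)
  have E_P: "(LINT x|\<mu> i. poly (P i n) x) = 0" if "i < d" "n \<noteq> 0" for i n
    unfolding P_def using \<mu>_in_class that by (intro integral_meixner_poly) auto
  have P_0: "P i 0 = 1" if "i < d" for i
    unfolding P_def using \<mu>_in_class[OF that] by (rule meixner_poly_0)
  have h_0: "h i 0 = 1" if "i < d" for i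
    using P_0[OF that] prob_space.prob_space[OF M[OF that]]
    by (simp add: h_def meixner_sqnorm_def P_def)

  \<comment> \<open>Expansion coefficients as expectations\<close>
  have coeff_h: "meixner_coeff u d \<mu> H n * (\<Prod>i<d. h i (n i)) = (LINT x|K. H x * (\<Prod>i<d. poly (P i (n i)) (x i)))"
    for n
  proof (cases "\<exists>i<d. h i (n i) = 0")
    \<comment> \<open>If some norm is 0, the corresponding polynomial vanishes almost everywhere.
      The expectation is then 0, in agreement with the factor \<open>h i (n i) = 0\<close> on the
      left.\<close>
    case True
    then obtain i where i: "i < d" "h i (n i) = 0" by blast
    have int: "integrable (\<mu> i) (\<lambda>x. (poly (P i (n i)) x)\<^sup>2)"
      using poly_int[OF i(1), of "(P i (n i))\<^sup>2"] by (subst (asm) poly_power[abs_def])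
    have "(LINT x|K. (poly (P i (n i)) (x i))\<^sup>2) = 0"
      using integral_coord[OF i(1) int] i(2) by (simp add: h_def meixner_sqnorm_def P_def)
    then have "AE x in K. (poly (P i (n i)) (x i))\<^sup>2 = 0"
      using integrable_coord[OF i(1) int] by (subst (asm) integral_nonneg_eq_0_iff_AE) auto
    then have "AE x in K. H x * (\<Prod>i<d. poly (P i (n i)) (x i)) = 0"
      by eventually_elim (use i(1) in auto)
    then have "(LINT x|K. H x * (\<Prod>i<d. poly (P i (n i)) (x i))) = 0"
      by (rule integral_eq_zero_AE)
    with True show ?thesis by (simp add: meixner_coeff_def h_def)
  next
    case False
    then have "(\<Prod>i<d. h i (n i)) \<noteq> 0" by auto
    with False show ?thesis
      unfolding meixner_coeff_def h_def P_def K_def by (simp only: if_False) simp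
  qed
  \<comment> \<open>When the product of the norms is 0, the coefficient is 0 by convention, so
    cancelling the norms is harmless.\<close>
  have coeff_0_iff: "meixner_coeff u d \<mu> H n = 0 \<longleftrightarrow> (LINT x|K. H x * (\<Prod>i<d. poly (P i (n i)) (x i))) = 0" for n
    unfolding coeff_h[symmetric] by (auto simp: meixner_coeff_def h_def)

  have Y: "distr \<Omega> K (\<lambda>\<omega>. \<lambda>i\<in>{..<d}. Y i \<omega>) = density K H"
    and Y_meas: "(\<lambda>\<omega>. \<lambda>i\<in>{..<d}. Y i \<omega>) \<in> measurable \<Omega> K"
    using assms(9) by (auto simp: distributed_def K_def)
  \<comment> \<open>Laws of functions of Y become images of \<open>density K H\<close>. The
    coordinates below d and their sum do not notice the restriction to
    \<open>{..<d}\<close>.\<close>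
  have distr_Y: "distr (density K H) borel T = distr \<Omega> borel (\<lambda>\<omega>. T (\<lambda>i\<in>{..<d}. Y i \<omega>))"
    if "T \<in> borel_measurable K" for T :: "(nat \<Rightarrow> real) \<Rightarrow> real"
    unfolding Y[symmetric] using that Y_meas by (subst distr_distr) (auto simp: comp_def)

  \<comment> \<open>Marginal laws\<close>
  have single: "distr \<Omega> borel (Y i) = \<mu> i \<longleftrightarrow>
      (\<forall>m\<ge>1. meixner_coeff u d \<mu> H (\<lambda>j. if j = i then m else 0) = 0)" if i: "i < d" for i
  proof -
    have "distr (density K H) borel (\<lambda>x. x i) = distr K borel (\<lambda>x. x i)
            \<longleftrightarrow> (\<forall>m\<ge>1. (LINT x|K. H x * poly (P i m) (x i)) = 0)"
    proof (rule distr_density_eq_iff_poly_basis[OF K.prob_space_axioms H coord[OF i] c])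
      show "integrable K (\<lambda>x. exp (c * \<bar>x i\<bar>))"
        using integrable_coord[OF i exp_int[OF i]] .
      show "degree (P i m) = m" for m
        unfolding P_def using \<mu>_in_class[OF i] by (rule degree_meixner_poly)
      show "(LINT x|K. poly (P i m) (x i)) = 0" if "m \<ge> 1" for m
        using integral_coord[OF i poly_int[OF i]] E_P[OF i] that by simp
    qed
    \<comment> \<open>The factors away from position i are \<open>P j 0 = 1\<close>.\<close>
    moreover have "(\<Prod>j<d. poly (P j (if j = i then m else 0)) (x j)) = poly (P i m) (x i)" for m x
    proof -
      have "(\<Prod>j<d. poly (P j (if j = i then m else 0)) (x j)) = (\<Prod>j<d. if j = i then poly (P i m) (x i) else 1)"
        by (intro prod.cong) (auto simp: P_0)
      then show ?thesis using i by simp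
    qed
    ultimately show ?thesis
      using i distr_Y[OF coord[OF i]] by (simp add: distr_coord coeff_0_iff)
  qed

  \<comment> \<open>Law of the sum\<close>
  obtain Q where deg_Q: "\<And>m. degree (Q m) = m"
    and Q: "\<And>m x. poly (Q m) (\<Sum>i<d. x i)
       = (\<Sum>n | n \<in> {..<d} \<rightarrow>\<^sub>E UNIV \<and> (\<Sum>i<d. n i) = m. \<Prod>i<d. poly (P i (n i)) (x i) / fact (n i))"
    using meixner_sum_poly_exists[OF assms(2), of u \<mu> P] meixner_classD(4)[OF \<mu>_in_class] 
    unfolding P_def by blast
  define I where "I = (\<lambda>m. {n \<in> {..<d} \<rightarrow>\<^sub>E (UNIV :: nat set). (\<Sum>i<d. n i) = m})"
  have Q: "poly (Q m) (\<Sum>i<d. x i) = (\<Sum>n\<in>I m. (\<Prod>i<d. poly (P i (n i)) (x i)) * (1 / (\<Prod>i<d. fact (n i))))" for m x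
    by (simp add: Q I_def prod_dividef)
  \<comment> \<open>Expectations of products factor over the coordinates, and a multi-index of total
    degree m >= 1 has a nonzero entry, whose factor is centred.\<close>
  have E_Q: "(LINT x|K. poly (Q m) (\<Sum>i<d. x i)) = 0" if m: "m \<ge> 1" for m
  proof -
    have "(LINT x|K. poly (Q m) (\<Sum>i<d. x i))
        = (\<Sum>n\<in>I m. (\<Prod>i<d. LINT x|\<mu> i. poly (P i (n i)) x) * (1 / (\<Prod>i<d. fact (n i))))"
      unfolding Q by (subst Bochner_Integration.integral_sum) (auto simp: prod_integral intro!: prod_int)
    also have "\<dots> = 0"
    proof (intro sum.neutral ballI)
      fix n assume "n \<in> I m"
      then have "(\<Sum>i<d. n i) \<noteq> 0" using m by (simp add: I_def)
      then obtain i where "i < d" "n i \<noteq> 0" by (auto simp: sum_eq_0_iff)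
      then show "(\<Prod>i<d. LINT x|\<mu> i. poly (P i (n i)) x) * (1 / (\<Prod>i<d. fact (n i))) = 0"
        using E_P by auto
    qed
    finally show ?thesis .
  qed
  \<comment> \<open>By \<open>coeff_h\<close> each expectation is a coefficient times its norms even
    when a norm vanishes, so the sum runs over all multi-indices without exception.\<close>
  have H_Q: "(LINT x|K. H x * poly (Q m) (\<Sum>i<d. x i))
      = (\<Sum>n\<in>I m. meixner_coeff u d \<mu> H n * (1 / (\<Prod>i<d. fact (n i))) * (\<Prod>i<d. h i (n i)))" for m
  proof -
    have "(LINT x|K. H x * poly (Q m) (\<Sum>i<d. x i))
        = (LINT x|K. (\<Sum>n\<in>I m. H x * (\<Prod>i<d. poly (P i (n i)) (x i)) * (1 / (\<Prod>i<d. fact (n i)))))"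
      unfolding Q by (simp add: sum_distrib_left mult.assoc)
    also have "\<dots> = (\<Sum>n\<in>I m. (LINT x|K. H x * (\<Prod>i<d. poly (P i (n i)) (x i))) * (1 / (\<Prod>i<d. fact (n i))))"
      by (subst Bochner_Integration.integral_sum) (auto intro!: H_prod_int)
    also have "\<dots> = (\<Sum>n\<in>I m. meixner_coeff u d \<mu> H n * (1 / (\<Prod>i<d. fact (n i))) * (\<Prod>i<d. h i (n i)))"
      unfolding coeff_h[symmetric] by (intro sum.cong) auto
    finally show ?thesis .
  qed
  have "distr (density K H) borel (\<lambda>x. \<Sum>i<d. x i) = distr K borel (\<lambda>x. \<Sum>i<d. x i)
          \<longleftrightarrow> (\<forall>m\<ge>1. (LINT x|K. H x * poly (Q m) (\<Sum>i<d. x i)) = 0)"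
  proof (rule distr_density_eq_iff_poly_basis[OF K.prob_space_axioms H _ c _ deg_Q E_Q])
    show "(\<lambda>x. \<Sum>i<d. x i) \<in> borel_measurable K" by simp
    have ind: "K.indep_vars (\<lambda>_. borel) (\<lambda>i x. exp (c * \<bar>x i\<bar>)) {..<d}"
      by (rule indep_f) simp
    have "integrable K (\<lambda>x. \<Prod>i<d. exp (c * \<bar>x i\<bar>))"
      using integrable_coord[OF _ exp_int] by (intro K.indep_vars_integrable ind) auto
    then show "integrable K (\<lambda>x. exp (c * \<bar>\<Sum>i<d. x i\<bar>))"
    proof (rule Bochner_Integration.integrable_bound)
      \<comment> \<open>The triangle inequality bounds the exponential of the sum by a product of
        independent integrable factors.\<close>
      have "exp (c * \<bar>\<Sum>i<d. x i\<bar>) \<le> (\<Prod>i<d. exp (c * \<bar>x i\<bar>))" for x :: "nat \<Rightarrow> real"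
        using c by (simp add: exp_sum[symmetric] sum_distrib_left[symmetric] sum_abs)
      then show "AE x in K. norm (exp (c * \<bar>\<Sum>i<d. x i\<bar>)) \<le> norm (\<Prod>i<d. exp (c * \<bar>x i\<bar>))"
        by (intro AE_I2) (auto simp: abs_prod)
    qed simp
  qed
  moreover have "iterated_convolution \<mu> d = distr K borel (\<lambda>x. \<Sum>i<d. x i)"
    using indep distr_coord by (rule K.iterated_convolution_eq_distr_sum)
  moreover have "distr (density K H) borel (\<lambda>x. \<Sum>i<d. x i) = distr \<Omega> borel (\<lambda>\<omega>. \<Sum>i<d. Y i \<omega>)"
    by (subst distr_Y) simp_all
  ultimately have "distr \<Omega> borel (\<lambda>\<omega>. \<Sum>i<d. Y i \<omega>) = iterated_convolution \<mu> d \<longleftrightarrow>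
      (\<forall>m\<ge>1. (\<Sum>n\<in>I m. meixner_coeff u d \<mu> H n * (1 / (\<Prod>i<d. fact (n i))) * (\<Prod>i<d. h i (n i))) = 0)"
    by (simp add: H_Q)
  then show ?thesis
    using single unfolding I_def h_def by blast
qed

end
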